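(* For $n\ge1$, $$\sum_{\pi\in\mathcal I_n(321)} q^{\mathrm{maj}(\pi)}=\binom{n}{\lfloor \frac{n}{2} \rfloor}_q.$$
   Context: $\mathcal I_n(321)$ is the set of involutions of $\{1,\dots,n\}$ avoiding the pattern $321$. $\mathrm{maj}(\pi)=\sum_{i:\pi(i)>\pi(i+1)} i$ is the major index. $\binom{n}{j}_q=\frac{(1-q^n)\cdots(1-q^{n-j+1})}{(1-q^j)\cdots(1-q)}$ is the $q$-binomial coefficient. *)

theory Defs
  imports
    "HOL-Combinatorics.Permutations"
    "HOL-Computational_Algebra.Polynomial_Factorial"
begin

text \<open>A permutation of \<open>{1..n}\<close> is a function \<open>\<pi> :: nat \<Rightarrow> nat\<close> with \<open>\<pi> permutes {1..n}\<close>,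
  so it is the identity outside \<open>{1..n}\<close>.  A pattern \<open>\<sigma>\<close> is given in one-line notation as a list;
  the list is indexed from 0, the positions \<open>f a\<close> in \<open>\<pi>\<close> from 1.\<close>

definition contains_pattern :: "nat \<Rightarrow> (nat \<Rightarrow> nat) \<Rightarrow> nat list \<Rightarrow> bool" where
  "contains_pattern n \<pi> \<sigma> \<longleftrightarrow>
     (\<exists>f. strict_mono_on {..<length \<sigma>} f \<and> f ` {..<length \<sigma>} \<subseteq> {1..n} \<and>
          (\<forall>a<length \<sigma>. \<forall>b<length \<sigma>. \<pi> (f a) < \<pi> (f b) \<longleftrightarrow> \<sigma> ! a < \<sigma> ! b))"

definition avoiding_involutions :: "nat \<Rightarrow> nat list \<Rightarrow> (nat \<Rightarrow> nat) set" where
  "avoiding_involutions n \<sigma> =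
     {\<pi>. \<pi> permutes {1..n} \<and> \<pi> \<circ> \<pi> = id \<and> \<not> contains_pattern n \<pi> \<sigma>}"

definition maj :: "nat \<Rightarrow> (nat \<Rightarrow> nat) \<Rightarrow> nat" where
  "maj n \<pi> = (\<Sum>i | i \<in> {1..<n} \<and> \<pi> i > \<pi> (i + 1). i)"

text \<open>As in the usual quotient formula, \<open>j \<le> n\<close> is understood and no \<open>q ^ i\<close> with
  \<open>1 \<le> i \<le> j\<close> may be \<open>1\<close> (otherwise division by zero gives 0).\<close>

definition q_binomial :: "'a::field \<Rightarrow> nat \<Rightarrow> nat \<Rightarrow> 'a" where
  "q_binomial q n j = (\<Prod>i<j. 1 - q ^ (n - i)) / (\<Prod>i=1..j. 1 - q ^ i)"

text \<open>The formal variable \<open>q\<close>, as an element of the fraction field of \<open>\<int>[q]\<close>.  Since \<open>\<int>[q]\<close> embeds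
  into it, an identity there between polynomials in \<open>q\<close> is an identity of polynomials.\<close>

definition q_var :: "int poly fract" where
  "q_var = to_fract [:0, 1:]"

end

theory Submission
  imports Defs
begin

text \<open>
  An involution \<open>\<pi>\<close> is encoded by the signs of \<open>\<pi> i - i\<close>, read as up, down and flat steps.
  Avoiding \<open>321\<close> means that the arcs of \<open>\<pi>\<close> are not nested and no fixed point lies under an arc.
  Hence the \<open>r\<close>-th up step is always matched with the \<open>r\<close>-th down step, the paths that occur are
  exactly the Motzkin paths whose flat steps lie on the axis, and the descents are the peaks.
  Let \<open>M(n, h)\<close> be the generating function of the sum of the peak positions over the prefixes of
  length \<open>n\<close> ending at height \<open>h\<close>.  Removing the last step gives, for \<open>n \<ge> 2\<close>,
  \<open>M(n, h) = M(n - 1, h - 1) + [h = 0] M(n - 1, 0) + M(n - 1, h + 1) - (1 - q^(n - 1)) M(n - 2, h)\<close>,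
  where \<open>M(n - 1, -1) = 0\<close>, and the Gaussian binomial of \<open>n\<close> over \<open>(n - h) div 2\<close> satisfies the
  same recurrence.\<close>

section \<open>Motzkin prefixes counted by their peaks\<close>

definition height :: "(nat \<Rightarrow> int) \<Rightarrow> nat \<Rightarrow> int" where
  "height s n = (\<Sum>i=1..n. s i)"

text \<open>Zeros outside \<open>{1..n}\<close> mirror permutations being the identity there, so
  that \<open>path_of \<pi> = s\<close> can be an equality of functions.\<close>

definition paths :: "nat \<Rightarrow> int \<Rightarrow> (nat \<Rightarrow> int) set" where
  "paths n h = {s. (\<forall>i. i \<notin> {1..n} \<longrightarrow> s i = 0) \<and> (\<forall>i. s i \<in> {-1, 0, 1}) \<and>
     (\<forall>i\<le>n. 0 \<le> height s i) \<and> (\<forall>i\<in>{1..n}. s i = 0 \<longrightarrow> height s i = 0) \<and> height s n = h}"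

text \<open>Index 0 carries weight 0, so starting the sum there is harmless.\<close>

definition peak_sum :: "nat \<Rightarrow> (nat \<Rightarrow> int) \<Rightarrow> nat" where
  "peak_sum n s = (\<Sum>i<n. if s i = 1 \<and> s (Suc i) = -1 then i else 0)"

definition path_gf :: "'a::field \<Rightarrow> nat \<Rightarrow> int \<Rightarrow> 'a" where
  "path_gf q n h = (\<Sum>s\<in>paths n h. q ^ peak_sum n s)"

lemma height_Suc: "height s (Suc n) = height s n + s (Suc n)"
  by (simp add: height_def)

lemma height_upd [simp]: "i < k \<Longrightarrow> height (s(k := x)) i = height s i"
  by (auto simp: height_def intro!: sum.cong)

lemma paths_0: "paths 0 h = (if h = 0 then {\<lambda>_. 0} else {})"
  by (auto simp: paths_def height_def)

lemma paths_neg: "h < 0 \<Longrightarrow> paths n h = {}"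
  by (auto simp: paths_def)

text \<open>Resetting the last step to 0 restores the zero padding of a shorter prefix; the
  remaining conditions concern only the new endpoint, which has height \<open>h\<close>.\<close>

lemma paths_Suc_iff:
  "s \<in> paths (Suc n) h \<longleftrightarrow>
     s(Suc n := 0) \<in> paths n (h - s (Suc n)) \<and> s (Suc n) \<in> {-1, 0, 1} \<and> 0 \<le> h \<and>
     (s (Suc n) = 0 \<longrightarrow> h = 0)"
  (is "?L \<longleftrightarrow> ?R")
proof
  assume L: ?L
  show ?R
    using L unfolding paths_def
    by (auto simp: height_Suc le_Suc_eq)
next
  assume R: ?R
  then have eq: "height s n = h - s (Suc n)"
    by (simp add: paths_def)
  have supp: "s i = 0" if "i \<notin> {1..Suc n}" for i
    using R that by (auto simp: paths_def dest!: spec[of _ i] split: if_splits)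
  have val: "s i \<in> {-1, 0, 1}" for i
    using R by (auto simp: paths_def dest!: spec[of _ i] split: if_splits)
  have nonneg: "0 \<le> height s i" if "i \<le> Suc n" for i
    using R that eq by (cases "i = Suc n") (auto simp: paths_def height_Suc)
  have flat: "height s i = 0" if "i \<in> {1..Suc n}" "s i = 0" for i
    using R that eq by (cases "i = Suc n") (auto simp: paths_def height_Suc)
  show ?L
    using supp val nonneg flat eq by (auto simp: paths_def height_Suc)
qed

lemma paths_vanish: "s \<in> paths n h \<Longrightarrow> s (Suc n) = 0"
  by (auto simp: paths_def)

text \<open>With \<open>inj_on_paths_upd\<close> this makes appending a fixed step a bijection,
  which is the change of variables in \<open>sum_paths_last\<close>.\<close>

lemma paths_Suc_last:
  assumes "x \<in> {-1, 0, 1}" "0 \<le> h" "x = 0 \<longrightarrow> h = 0"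
  shows "{s \<in> paths (Suc n) h. s (Suc n) = x} = (\<lambda>s. s(Suc n := x)) ` paths n (h - x)"
    (is "?A = ?B")
proof
  show "?A \<subseteq> ?B"
  proof
    fix s assume "s \<in> ?A"
    then have "s = (s(Suc n := 0))(Suc n := x)" "s(Suc n := 0) \<in> paths n (h - x)"
      by (auto simp: paths_Suc_iff)
    then show "s \<in> ?B" by blast
  qed
  show "?B \<subseteq> ?A"
    using assms by (auto simp: paths_Suc_iff fun_upd_idem paths_vanish)
qed

lemma inj_on_paths_upd: "inj_on (\<lambda>s. s(Suc n := x)) (paths n h)"
  by (rule inj_on_inverseI[where g = "\<lambda>s. s(Suc n := 0)"]) (simp add: fun_upd_idem paths_vanish)

lemma paths_Suc:
  assumes "0 \<le> h"
  shows "paths (Suc n) h = {s \<in> paths (Suc n) h. s (Suc n) = 1} \<union>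
     {s \<in> paths (Suc n) h. s (Suc n) = -1} \<union>
     (if h = 0 then {s \<in> paths (Suc n) h. s (Suc n) = 0} else {})"
  by (auto simp: paths_Suc_iff)

lemma finite_paths: "finite (paths n h)"
proof (induction n arbitrary: h)
  case 0
  then show ?case by (simp add: paths_0)
next
  case (Suc n)
  show ?case
  proof (cases "h < 0")
    case False
    then show ?thesis
      by (subst paths_Suc) (auto simp: paths_Suc_last Suc)
  qed (simp add: paths_neg)
qed

lemma peak_sum_Suc:
  "peak_sum (Suc n) s = peak_sum n s + (if s n = 1 \<and> s (Suc n) = -1 then n else 0)"
  by (simp add: peak_sum_def)

lemma peak_sum_upd [simp]: "peak_sum n (s(Suc n := x)) = peak_sum n s"
  by (auto simp: peak_sum_def intro!: sum.cong)

lemma sum_paths_last: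
  assumes "x \<in> {-1, 0, 1}" "0 \<le> h" "x = 0 \<longrightarrow> h = 0"
  shows "(\<Sum>s | s \<in> paths (Suc n) h \<and> s (Suc n) = x. q ^ peak_sum (Suc n) s) =
     (\<Sum>s\<in>paths n (h - x). q ^ (peak_sum n s + (if s n = 1 \<and> x = -1 then n else 0)))"
  unfolding paths_Suc_last[OF assms]
  by (subst sum.reindex[OF inj_on_paths_upd]) (simp add: peak_sum_Suc)

text \<open>Split by the last step: up from \<open>h - 1\<close>, flat only on the axis, down from
  \<open>h + 1\<close>. Only a down step can complete a peak, and that peak lies at position
  \<open>n\<close>. For \<open>h = 0\<close> the first term is an empty sum.\<close>

lemma path_gf_Suc:
  fixes q :: "'a::field"
  assumes "0 \<le> h"
  shows "path_gf q (Suc n) h = path_gf q n (h - 1) + (if h = 0 then path_gf q n 0 else 0) +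
     (\<Sum>s\<in>paths n (h + 1). q ^ (peak_sum n s + (if s n = 1 then n else 0)))"
proof -
  let ?A = "\<lambda>x. {s. s \<in> paths (Suc n) h \<and> s (Suc n) = x}"
  let ?w = "\<lambda>s. q ^ peak_sum (Suc n) s"
  have "path_gf q (Suc n) h = sum ?w (?A 1 \<union> ?A (-1) \<union> (if h = 0 then ?A 0 else {}))"
    unfolding path_gf_def by (subst paths_Suc[OF assms]) simp
  also have "\<dots> = sum ?w (?A 1) + sum ?w (?A (-1)) + (if h = 0 then sum ?w (?A 0) else 0)"
    by (subst sum.union_disjoint; (auto simp: finite_paths)?)+
  also have "\<dots> = path_gf q n (h - 1) +
     (\<Sum>s\<in>paths n (h + 1). q ^ (peak_sum n s + (if s n = 1 then n else 0))) +
     (if h = 0 then path_gf q n 0 else 0)"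
    using assms by (simp add: sum_paths_last path_gf_def)
  finally show ?thesis by (simp add: algebra_simps)
qed

lemma path_gf_Suc_0: "0 \<le> h \<Longrightarrow> path_gf q (Suc 0) h = (if h \<le> 1 then 1 else 0)"
  by (auto simp: path_gf_Suc path_gf_def[of q 0] paths_0 peak_sum_def)

text \<open>A down step after an up step contributes the extra factor \<open>q ^ Suc n\<close>; the prefixes
  concerned are those ending in an up step, which are counted by \<open>path_gf q n h\<close>.\<close>

lemma path_gf_Suc_Suc:
  fixes q :: "'a::field"
  assumes "0 \<le> h"
  shows "path_gf q (Suc (Suc n)) h =
     path_gf q (Suc n) (h - 1) + (if h = 0 then path_gf q (Suc n) 0 else 0) +
     path_gf q (Suc n) (h + 1) - (1 - q ^ Suc n) * path_gf q n h"
proof -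
  let ?P = "paths (Suc n) (h + 1)" and ?w = "\<lambda>s. q ^ peak_sum (Suc n) s"
  have "(\<Sum>s\<in>?P. q ^ (peak_sum (Suc n) s + (if s (Suc n) = 1 then Suc n else 0))) =
      (\<Sum>s\<in>?P. ?w s - (1 - q ^ Suc n) * (if s (Suc n) = 1 then ?w s else 0))"
    by (intro sum.cong) (auto simp: power_add algebra_simps)
  also have "\<dots> = path_gf q (Suc n) (h + 1) -
      (1 - q ^ Suc n) * (\<Sum>s\<in>?P. if s (Suc n) = 1 then ?w s else 0)"
    by (simp add: sum_subtractf path_gf_def flip: sum_distrib_left)
  also have "(\<Sum>s\<in>?P. if s (Suc n) = 1 then ?w s else 0) = (\<Sum>s | s \<in> ?P \<and> s (Suc n) = 1. ?w s)"
    by (simp add: sum.inter_filter finite_paths)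
  also have "\<dots> = path_gf q n h"
    using assms by (simp add: sum_paths_last path_gf_def)
  finally show ?thesis
    using path_gf_Suc[OF assms, of q "Suc n"] by simp
qed

section \<open>Gaussian binomials\<close>

lemma q_binomial_0 [simp]: "q_binomial q n 0 = 1"
  by (simp add: q_binomial_def)

lemma q_binomial_Suc:
  "q_binomial q n (Suc j) = q_binomial q n j * (1 - q ^ (n - j)) / (1 - q ^ Suc j)"
  by (simp add: q_binomial_def)

text \<open>The factor \<open>1 - q ^ (Suc n - j)\<close> extends the numerator of the left binomial
  by one term at its end; the same product is the numerator of the right one with
  \<open>1 - q ^ Suc n\<close> put in front.\<close>

lemma q_binomial_absorb:
  fixes q :: "'a::field"
  shows "(1 - q ^ (Suc n - j)) * q_binomial q (Suc n) j = (1 - q ^ Suc n) * q_binomial q n j"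
proof (induction j)
  case (Suc j)
  have "(1 - q ^ (Suc n - Suc j)) * q_binomial q (Suc n) (Suc j) =
      ((1 - q ^ (Suc n - j)) * q_binomial q (Suc n) j) * (1 - q ^ (n - j)) / (1 - q ^ Suc j)"
    by (simp add: q_binomial_Suc)
  then show ?case
    unfolding Suc by (simp add: q_binomial_Suc)
qed simp

lemma q_binomial_Suc_Suc:
  fixes q :: "'a::field"
  assumes "\<And>i. 0 < i \<Longrightarrow> q ^ i \<noteq> 1"
  shows "q_binomial q (Suc n) (Suc j) = (1 - q ^ Suc n) / (1 - q ^ Suc j) * q_binomial q n j"
proof (induction j)
  case 0
  then show ?case by (simp add: q_binomial_Suc)
next
  case (Suc j)
  show ?case
    by (subst q_binomial_Suc, subst Suc) (simp add: q_binomial_Suc mult_ac)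
qed

text \<open>Writing every term as a multiple of \<open>q_binomial q n j\<close> and clearing
  \<open>1 - q ^ Suc j\<close> leaves \<open>1 - q ^ Suc n = (1 - q ^ (n - j)) + q ^ (n - j) * (1 -
  q ^ Suc j)\<close>.\<close>

lemma q_binomial_pascal:
  fixes q :: "'a::field"
  assumes q: "\<And>i. 0 < i \<Longrightarrow> q ^ i \<noteq> 1" and "j \<le> n"
  shows "q_binomial q (Suc n) (Suc j) = q_binomial q n (Suc j) + q ^ (n - j) * q_binomial q n j"
proof -
  have nz: "1 - q ^ Suc j \<noteq> 0"
    using q[of "Suc j"] by simp
  have "q ^ (n - j) * q ^ Suc j = q ^ Suc n"
    using \<open>j \<le> n\<close> by (simp flip: power_add)
  moreover have "q_binomial q (Suc n) (Suc j) = (1 - q ^ Suc n) / (1 - q ^ Suc j) * q_binomial q n j"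
    by (rule q_binomial_Suc_Suc[OF q])
  ultimately show ?thesis
    using nz by (simp add: q_binomial_Suc[of q n j] field_simps del: power_Suc)
qed

text \<open>The Pascal rule at \<open>Suc n\<close> has the coefficient
  \<open>q ^ (Suc n - j)\<close>. Writing it as \<open>1 - (1 - q ^ (Suc n - j))\<close> and
  absorbing the second part gives the shape of \<open>path_gf_Suc_Suc\<close>.\<close>

lemma q_binomial_step:
  fixes q :: "'a::field"
  assumes q: "\<And>i. 0 < i \<Longrightarrow> q ^ i \<noteq> 1" and "j \<le> n"
  shows "q_binomial q (Suc (Suc n)) (Suc j) =
    q_binomial q (Suc n) (Suc j) + q_binomial q (Suc n) j - (1 - q ^ Suc n) * q_binomial q n j"
  using q_binomial_pascal[OF q, of j "Suc n"] q_binomial_absorb[of q n j] \<open>j \<le> n\<close>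
  by (simp add: algebra_simps del: power_Suc)

text \<open>The symmetry of the two central coefficients: their quotient is
  \<open>(1 - q ^ Suc k) / (1 - q ^ Suc k)\<close>.\<close>

lemma q_binomial_central:
  fixes q :: "'a::field"
  assumes q: "\<And>i. 0 < i \<Longrightarrow> q ^ i \<noteq> 1"
  shows "q_binomial q (Suc (2 * k)) (Suc k) = q_binomial q (Suc (2 * k)) k"
proof -
  have "Suc (2 * k) - k = Suc k" by simp
  then show ?thesis
    using q[of "Suc k"] by (simp add: q_binomial_Suc del: power_Suc)
qed

text \<open>The recurrence reaches back two lengths, hence the two base cases. Both parities of
  \<open>n - h\<close> occur because of the flat steps on the axis; \<open>div 2\<close> treats them
  uniformly.\<close>

lemma path_gf_eq_q_binomial:
  fixes q :: "'a::field"
  assumes q: "\<And>i. 0 < i \<Longrightarrow> q ^ i \<noteq> 1"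
  shows "path_gf q n (int h) = (if h \<le> n then q_binomial q n ((n - h) div 2) else 0)"
proof (induction n arbitrary: h rule: induct_nat_012)
  case 0
  then show ?case by (simp add: path_gf_def paths_0 peak_sum_def)
next
  case 1
  then show ?case by (auto simp: path_gf_Suc_0)
next
  case (ge2 n)
  have down: "path_gf q (Suc n) (int h + 1) =
      (if h \<le> n then q_binomial q (Suc n) ((n - h) div 2) else 0)"
    using ge2(2)[of "Suc h"] by (simp add: add.commute)
  \<comment> \<open>At height 0 the flat step takes the place of the impossible up step from -1, so
    one formula serves every \<open>h\<close>.\<close>
  have up: "path_gf q (Suc n) (int h - 1) + (if int h = 0 then path_gf q (Suc n) 0 else 0) =
      (if h \<le> Suc (Suc n) then q_binomial q (Suc n) ((Suc (Suc n) - h) div 2) else 0)"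
  proof (cases h)
    case 0
    \<comment> \<open>For odd \<open>n\<close> the two lower indices coincide; for even
      \<open>n\<close> they are the two central ones.\<close>
    have "q_binomial q (Suc n) (Suc n div 2) = q_binomial q (Suc n) (Suc (Suc n) div 2)"
    proof (cases "even n")
      case True
      then obtain k where "n = 2 * k" by (elim evenE)
      then show ?thesis using q_binomial_central[OF q, of k] by simp
    qed simp
    then show ?thesis using 0 ge2(2)[of 0] by (simp add: path_gf_def paths_neg)
  next
    case (Suc k)
    then show ?thesis using ge2(2)[of k] by simp
  qed
  have rec: "path_gf q (Suc (Suc n)) (int h) =
     (if h \<le> Suc (Suc n) then q_binomial q (Suc n) ((Suc (Suc n) - h) div 2) else 0) +
     (if h \<le> n then q_binomial q (Suc n) ((n - h) div 2) else 0) -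
     (1 - q ^ Suc n) * (if h \<le> n then q_binomial q n ((n - h) div 2) else 0)"
    unfolding path_gf_Suc_Suc[OF of_nat_0_le_iff] up down ge2(1) ..
  show ?case
  proof (cases "h \<le> n")
    case True
    then have "(Suc (Suc n) - h) div 2 = Suc ((n - h) div 2)" by (simp add: Suc_diff_le)
    then show ?thesis
      unfolding rec using True q_binomial_step[OF q, of "(n - h) div 2" n] by simp
  next
    \<comment> \<open>At heights \<open>n + 1\<close> and \<open>n + 2\<close> both binomials have
      lower index 0 and equal 1; above that both sides vanish.\<close>
    case False
    then have "(Suc (Suc n) - h) div 2 = 0" by simp
    then show ?thesis
      unfolding rec using False by simp
  qed
qed

section \<open>Powers of the formal variable\<close>

lemma to_fract_power: "to_fract (x ^ i) = to_fract x ^ i"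
  by (induction i) simp_all

text \<open>The embedding of polynomials is injective and the \<open>i\<close>-th power of the
  variable has degree \<open>i\<close>. This keeps the denominators of \<open>q_binomial\<close>
  nonzero.\<close>

lemma q_var_power_neq_1: "0 < i \<Longrightarrow> q_var ^ i \<noteq> 1"
proof
  assume "0 < i" and "q_var ^ i = 1"
  then have "to_fract ([:0, 1:] ^ i) = to_fract (1 :: int poly)"
    by (simp add: q_var_def to_fract_power)
  then have "([:0, 1:] :: int poly) ^ i = 1"
    by (simp only: to_fract_eq_iff)
  then have "degree (([:0, 1:] :: int poly) ^ i) = 0" by simp
  then show False using \<open>0 < i\<close> by (simp add: degree_power_eq)
qed

section \<open>From involutions to paths\<close>

definition path_of :: "(nat \<Rightarrow> nat) \<Rightarrow> nat \<Rightarrow> int" where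
  "path_of \<pi> i = sgn (int (\<pi> i) - int i)"

lemma path_of_simps [simp]:
  "path_of \<pi> i = 1 \<longleftrightarrow> i < \<pi> i" "path_of \<pi> i = -1 \<longleftrightarrow> \<pi> i < i" "path_of \<pi> i = 0 \<longleftrightarrow> \<pi> i = i"
  by (auto simp: path_of_def sgn_if)

lemma path_of_eq_cases:
  assumes "path_of \<pi> = path_of \<rho>"
  shows "i < \<pi> i \<longleftrightarrow> i < \<rho> i" "\<pi> i < i \<longleftrightarrow> \<rho> i < i" "\<pi> i = i \<longleftrightarrow> \<rho> i = i"
  by (simp_all only: assms flip: path_of_simps[of \<pi> i] path_of_simps[of \<rho> i])

lemma contains_321_iff:
  "contains_pattern n \<pi> [3, 2, 1] \<longleftrightarrow>
     (\<exists>i j k. 1 \<le> i \<and> i < j \<and> j < k \<and> k \<le> n \<and> \<pi> i > \<pi> j \<and> \<pi> j > \<pi> k)" (is "?L \<longleftrightarrow> ?R")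
proof -
  have len: "length [3, 2, 1 :: nat] = 3" by simp
  show ?thesis
  proof
    assume ?L
    from this[unfolded contains_pattern_def len]
    obtain f where f: "strict_mono_on {..<3} f" "f ` {..<3} \<subseteq> {1..n}"
      and ord: "\<forall>a<3. \<forall>b<3. \<pi> (f a) < \<pi> (f b) \<longleftrightarrow> [3, 2, 1 :: nat] ! a < [3, 2, 1] ! b"
      by blast
    have "f 0 < f 1" "f 1 < f 2"
      using f(1) by (auto simp: strict_mono_on_def)
    moreover have "\<pi> (f 0) > \<pi> (f 1)" "\<pi> (f 1) > \<pi> (f 2)"
      using ord[rule_format, of 1 0] ord[rule_format, of 2 1] by (simp_all add: numeral_2_eq_2)
    moreover have "1 \<le> f 0" "f 2 \<le> n"
      using subsetD[OF f(2), of "f 0"] subsetD[OF f(2), of "f 2"] by simp_all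
    ultimately show ?R by blast
  next
    assume ?R
    then obtain i j k where ijk: "1 \<le> i" "i < j" "j < k" "k \<le> n" "\<pi> i > \<pi> j" "\<pi> j > \<pi> k"
      by blast
    have "strict_mono_on {..<3} (\<lambda>a. [i, j, k] ! a)"
      using ijk by (auto simp: strict_mono_on_def less_Suc_eq numeral_3_eq_3)
    moreover have "(\<lambda>a. [i, j, k] ! a) ` {..<3} \<subseteq> {1..n}"
      using ijk by (auto simp: less_Suc_eq numeral_3_eq_3)
    moreover have "\<forall>a<3. \<forall>b<3. \<pi> ([i, j, k] ! a) < \<pi> ([i, j, k] ! b) \<longleftrightarrow>
        [3, 2, 1 :: nat] ! a < [3, 2, 1] ! b"
      using ijk by (auto simp: less_Suc_eq numeral_3_eq_3)
    ultimately show ?L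
      unfolding contains_pattern_def len by blast
  qed
qed

lemma height_eq_card:
  assumes "\<And>i. s i \<in> {-1, 0, 1}"
  shows "height s n = int (card {i \<in> {1..n}. s i = 1}) - int (card {i \<in> {1..n}. s i = -1})"
proof -
  have "height s n = (\<Sum>i=1..n. (if s i = 1 then 1 else 0) - (if s i = -1 then 1 else 0))"
    unfolding height_def using assms by (intro sum.cong) force+
  then show ?thesis by (simp add: sum_subtractf flip: sum.inter_filter)
qed

section \<open>Structure of a single involution avoiding 321\<close>

locale avoiding_involution =
  fixes n :: nat and \<pi> :: "nat \<Rightarrow> nat"
  assumes mem: "\<pi> \<in> avoiding_involutions n [3, 2, 1]"
begin

lemma permutes: "\<pi> permutes {1..n}"
  using mem by (simp add: avoiding_involutions_def)

lemma invol [simp]: "\<pi> (\<pi> i) = i"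
  using mem by (auto simp: avoiding_involutions_def fun_eq_iff)

lemma eq_iff [simp]: "\<pi> i = \<pi> j \<longleftrightarrow> i = j"
  by (metis invol)

lemma range_iff [simp]: "1 \<le> \<pi> i \<and> \<pi> i \<le> n \<longleftrightarrow> 1 \<le> i \<and> i \<le> n"
  using permutes_in_image[OF permutes, of i] by simp

lemma outside: "\<not> (1 \<le> i \<and> i \<le> n) \<Longrightarrow> \<pi> i = i"
  using permutes_not_in[OF permutes, of i] by auto

lemma moved: "\<pi> i \<noteq> i \<Longrightarrow> 1 \<le> i \<and> i \<le> n"
  using outside by blast

text \<open>Positions of such a triple lie in \<open>{1..n}\<close> automatically: 0 is fixed with
  the least value, and \<open>k > n\<close> would give \<open>\<pi> j > k > n\<close>, making
  \<open>\<pi> j\<close> a fixed point and forcing \<open>j = \<pi> j\<close>.\<close>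

lemma no_321:
  assumes "i < j" "j < k" "\<pi> i > \<pi> j" "\<pi> j > \<pi> k"
  shows False
proof -
  have "1 \<le> i"
    using assms outside[of 0] by (cases i) auto
  moreover have "k \<le> n"
  proof (rule ccontr)
    assume "\<not> k \<le> n"
    then have "\<pi> (\<pi> j) = \<pi> j"
      using assms outside[of k] outside[of "\<pi> j"] by simp
    then show False
      using assms outside[of k] \<open>\<not> k \<le> n\<close> by simp
  qed
  ultimately have "contains_pattern n \<pi> [3, 2, 1]"
    using assms unfolding contains_321_iff by blast
  then show False
    using mem by (simp add: avoiding_involutions_def)
qed

text \<open>Nested arcs would yield 321 at the positions \<open>i\<close>, \<open>j\<close>,
  \<open>\<pi> j\<close>.\<close>

lemma mono_on_exceedances:
  assumes "i < j" "i < \<pi> i" "j < \<pi> j"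
  shows "\<pi> i < \<pi> j"
proof -
  have "\<not> \<pi> j < \<pi> i"
    using no_321[of i j "\<pi> j"] assms by auto
  moreover have "\<pi> i \<noteq> \<pi> j"
    using assms by simp
  ultimately show ?thesis by linarith
qed

text \<open>A descent whose ends have any other signs extends to 321 by a partner:
  \<open>\<pi> i\<close> or \<open>\<pi> (Suc i)\<close> on the right if \<open>Suc i\<close> is not
  a deficiency, \<open>\<pi> (Suc i)\<close> on the left if \<open>i\<close> is not an
  exceedance.\<close>

lemma descent_iff: "\<pi> (Suc i) < \<pi> i \<longleftrightarrow> i < \<pi> i \<and> \<pi> (Suc i) < Suc i"
proof
  assume desc: "\<pi> (Suc i) < \<pi> i"
  have "\<pi> (Suc i) < Suc i"
  proof (rule ccontr)
    assume "\<not> \<pi> (Suc i) < Suc i"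
    then consider "\<pi> (Suc i) = Suc i" | "Suc i < \<pi> (Suc i)" by linarith
    then show False
    proof cases
      case 1
      then show False using no_321[of i "Suc i" "\<pi> i"] desc by simp
    next
      case 2
      then show False using no_321[of i "Suc i" "\<pi> (Suc i)"] desc by simp
    qed
  qed
  moreover have "i < \<pi> i"
  proof (rule ccontr)
    assume "\<not> i < \<pi> i"
    then show False
      using no_321[of "\<pi> (Suc i)" i "Suc i"] desc by simp
  qed
  ultimately show "i < \<pi> i \<and> \<pi> (Suc i) < Suc i" by simp
qed simp

lemma maj_eq_peak_sum: "maj n \<pi> = peak_sum n (path_of \<pi>)"
proof -
  have "maj n \<pi> = (\<Sum>i\<in>{1..<n}. if \<pi> (Suc i) < \<pi> i then i else 0)"
    unfolding maj_def by (subst sum.inter_filter[symmetric]) simp_all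
  also have "\<dots> = (\<Sum>i<n. if \<pi> (Suc i) < \<pi> i then i else 0)"
    by (rule sum.mono_neutral_left) (auto simp: not_le less_Suc_eq_0_disj)
  finally show ?thesis
    by (simp add: peak_sum_def descent_iff)
qed

lemma height_path_of:
  "height (path_of \<pi>) i = int (card {j \<in> {1..i}. j < \<pi> j}) - int (card {j \<in> {1..i}. \<pi> j < j})"
  by (subst height_eq_card) (simp add: path_of_def sgn_if, simp)

lemma height_path_of_nonneg: "0 \<le> height (path_of \<pi>) i"
proof -
  have "card {j \<in> {1..i}. \<pi> j < j} \<le> card {j \<in> {1..i}. j < \<pi> j}"
  \<comment> \<open>Every arc closed within the prefix was also opened there.\<close>
  proof (rule card_inj_on_le[of \<pi>])
    show "\<pi> ` {j \<in> {1..i}. \<pi> j < j} \<subseteq> {j \<in> {1..i}. j < \<pi> j}"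
      using moved range_iff by fastforce
  qed (auto simp: inj_on_def)
  then show ?thesis by (simp add: height_path_of)
qed

text \<open>When no arc leaves the prefix, \<open>\<pi>\<close> also injects its openings into its
  closings. This applies at \<open>n\<close> and at fixed points.\<close>

lemma height_path_of_eq_0:
  assumes "\<And>j. j \<le> i \<Longrightarrow> \<pi> j \<le> i"
  shows "height (path_of \<pi>) i = 0"
proof -
  have "card {j \<in> {1..i}. j < \<pi> j} \<le> card {j \<in> {1..i}. \<pi> j < j}"
  proof (rule card_inj_on_le[of \<pi>])
    show "\<pi> ` {j \<in> {1..i}. j < \<pi> j} \<subseteq> {j \<in> {1..i}. \<pi> j < j}"
    proof
      fix k assume "k \<in> \<pi> ` {j \<in> {1..i}. j < \<pi> j}"
      then obtain j where "k = \<pi> j" "1 \<le> j" "j \<le> i" "j < \<pi> j" by auto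
      then show "k \<in> {j \<in> {1..i}. \<pi> j < j}"
        using assms[of j] by simp
    qed
  qed (auto simp: inj_on_def)
  then show ?thesis
    using height_path_of_nonneg[of i] by (simp add: height_path_of)
qed

lemma path_of_in_paths: "path_of \<pi> \<in> paths n 0"
proof -
  have "height (path_of \<pi>) n = 0"
  proof (rule height_path_of_eq_0)
    show "\<pi> j \<le> n" if "j \<le> n" for j
      using that range_iff[of j] outside[of j] by (cases "1 \<le> j") simp_all
  qed
  \<comment> \<open>An arc from \<open>j\<close> over a fixed point \<open>i\<close> would give 321
    at \<open>j\<close>, \<open>i\<close>, \<open>\<pi> j\<close>.\<close>
  moreover have "height (path_of \<pi>) i = 0" if "\<pi> i = i" for i
  proof (rule height_path_of_eq_0, rule ccontr)
    fix j assume "j \<le> i" "\<not> \<pi> j \<le> i"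
    then show False
      using no_321[of j i "\<pi> j"] that by (cases "j = i") auto
  qed
  ultimately show ?thesis
    using outside height_path_of_nonneg by (auto simp: paths_def path_of_def sgn_if)
qed

end

text \<open>Suppose \<open>\<pi> u < \<rho> u\<close>. Equal signs make \<open>\<pi> u\<close> a
  deficiency of \<open>\<rho>\<close> too, with partner \<open>v\<close>. Since
  \<open>\<rho> v = \<pi> u < \<rho> u\<close>, monotonicity puts \<open>v\<close> before
  \<open>u\<close>; agreement below \<open>u\<close> then gives \<open>\<pi> v = \<pi> u\<close>,
  contradicting injectivity.\<close>

lemma path_of_determines_least:
  assumes "avoiding_involution n \<pi>" "avoiding_involution n \<rho>" and eq: "path_of \<pi> = path_of \<rho>"
    and u: "u < \<pi> u" and IH: "\<And>v. v < u \<Longrightarrow> v < \<pi> v \<Longrightarrow> \<pi> v = \<rho> v"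
  shows "\<not> \<pi> u < \<rho> u"
proof
  interpret p: avoiding_involution n \<pi> by fact
  interpret r: avoiding_involution n \<rho> by fact
  note same = path_of_eq_cases[OF eq]
  assume less: "\<pi> u < \<rho> u"
  define v where "v = \<rho> (\<pi> u)"
  have v: "v < \<rho> v" "\<rho> v = \<pi> u"
    using u same(2)[of "\<pi> u"] by (simp_all add: v_def)
  have "v < u"
  proof (rule ccontr)
    assume "\<not> v < u"
    then consider "v = u" | "u < v" by linarith
    then show False
      using r.mono_on_exceedances[of u v] u v less same(1)[of u] by cases auto
  qed
  moreover from this have "\<pi> v = \<pi> u"
    using IH[of v] v same(1)[of v] by simp
  ultimately show False by simp
qed

lemma inj_on_path_of: "inj_on path_of (avoiding_involutions n [3, 2, 1])"
proof (rule inj_onI)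
  fix \<pi> \<rho>
  assume "\<pi> \<in> avoiding_involutions n [3, 2, 1]" "\<rho> \<in> avoiding_involutions n [3, 2, 1]"
    and eq: "path_of \<pi> = path_of \<rho>"
  then have ai: "avoiding_involution n \<pi>" "avoiding_involution n \<rho>"
    by (simp_all add: avoiding_involution_def)
  interpret p: avoiding_involution n \<pi> by fact
  interpret r: avoiding_involution n \<rho> by fact
  note same = path_of_eq_cases[OF eq]
  have exc: "u < \<pi> u \<longrightarrow> \<pi> u = \<rho> u" for u
  proof (induction u rule: less_induct)
    case (less u)
    show ?case
    proof
      assume "u < \<pi> u"
      moreover have "\<not> \<pi> u < \<rho> u"
        using less by (intro path_of_determines_least[OF ai eq] \<open>u < \<pi> u\<close>) simp
      moreover have "\<not> \<rho> u < \<pi> u"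
        using less \<open>u < \<pi> u\<close> same(1)
        by (intro path_of_determines_least[OF ai(2,1) eq[symmetric]]) simp_all
      ultimately show "\<pi> u = \<rho> u" by simp
    qed
  qed
  show "\<pi> = \<rho>"
  proof
    fix i
    consider "i < \<pi> i" | "\<pi> i = i" | "\<pi> i < i" by linarith
    then show "\<pi> i = \<rho> i"
    proof cases
      case 3
      then have "\<rho> (\<pi> i) = i" using exc[of "\<pi> i"] by simp
      then show ?thesis by (metis r.invol)
    qed (use exc same(3) in auto)
  qed
qed

section \<open>From paths to involutions\<close>

text \<open>The point \<open>x\<close> may lie outside \<open>A\<close>, so up and down steps can be
  counted at a common position.\<close>

definition rank :: "nat set \<Rightarrow> nat \<Rightarrow> nat" where
  "rank A x = card {a \<in> A. a \<le> x}"

lemma rank_mono: "x \<le> y \<Longrightarrow> rank A x \<le> rank A y"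
  unfolding rank_def by (rule card_mono) auto

lemma rank_less:
  assumes "x < y" "y \<in> A"
  shows "rank A x < rank A y"
proof -
  have "y \<in> {a \<in> A. a \<le> y} - {a \<in> A. a \<le> x}"
    using assms by simp
  moreover have "{a \<in> A. a \<le> x} \<subseteq> {a \<in> A. a \<le> y}"
    using assms by auto
  ultimately show ?thesis
    unfolding rank_def by (intro psubset_card_mono) auto
qed

lemma inj_on_rank: "inj_on (rank A) A"
  by (rule inj_onI) (metis rank_less linorder_neqE_nat less_irrefl)

lemma rank_image:
  assumes "finite A"
  shows "rank A ` A = {1..card A}"
proof (rule card_subset_eq)
  show "rank A ` A \<subseteq> {1..card A}"
  proof
    fix k assume "k \<in> rank A ` A"
    then obtain a where a: "a \<in> A" "k = rank A a" by blast
    have "rank A a \<le> card A"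
      unfolding rank_def using assms by (intro card_mono) auto
    moreover have "0 < rank A a"
      unfolding rank_def using a by (auto simp: card_gt_0_iff)
    ultimately show "k \<in> {1..card A}" using a by simp
  qed
qed (simp_all add: card_image inj_on_rank)

text \<open>Ranks number both sets by the same interval, so swapping elements of equal rank is a
  perfect matching; disjointness makes it a well-defined involution.\<close>

lemma rank_matching:
  assumes fin: "finite U" "finite D" and disj: "U \<inter> D = {}" and card: "card U = card D"
  obtains \<pi> :: "nat \<Rightarrow> nat" where
    "\<And>u. u \<in> U \<Longrightarrow> \<pi> u \<in> D \<and> rank D (\<pi> u) = rank U u"
    "\<And>d. d \<in> D \<Longrightarrow> \<pi> d \<in> U \<and> rank U (\<pi> d) = rank D d"
    "\<And>i. i \<notin> U \<Longrightarrow> i \<notin> D \<Longrightarrow> \<pi> i = i"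
    "\<And>i. \<pi> (\<pi> i) = i"
proof -
  define f where "f u = inv_into D (rank D) (rank U u)" for u
  define g where "g d = inv_into U (rank U) (rank D d)" for d
  have im: "rank U ` U = rank D ` D"
    using fin card by (simp add: rank_image)
  have f: "f u \<in> D" "rank D (f u) = rank U u" if "u \<in> U" for u
    unfolding f_def using that im by (auto intro!: inv_into_into f_inv_into_f)
  have g: "g d \<in> U" "rank U (g d) = rank D d" if "d \<in> D" for d
    unfolding g_def using that im[symmetric] by (auto intro!: inv_into_into f_inv_into_f)
  have gf: "g (f u) = u" if "u \<in> U" for u
    unfolding g_def using that f by (simp add: inj_on_rank)
  have fg: "f (g d) = d" if "d \<in> D" for d
    unfolding f_def using that g by (simp add: inj_on_rank)
  define \<pi> where "\<pi> i = (if i \<in> U then f i else if i \<in> D then g i else i)" for i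
  show thesis
    by (rule that[of \<pi>]) (use f g gf fg disj in \<open>auto simp: \<pi>_def\<close>)
qed

text \<open>Matching steps by rank preserves order, which excludes nested arcs. Nonnegative heights
  put each up step before its partner, and flat steps at height 0 lie under no arc.\<close>

lemma path_of_surj:
  assumes s: "s \<in> paths n 0"
  obtains \<pi> where "\<pi> \<in> avoiding_involutions n [3, 2, 1]" "path_of \<pi> = s"
proof -
  define U where "U = {i. s i = 1}"
  define D where "D = {i. s i = -1}"
  have val: "s i \<in> {-1, 0, 1}" for i
    using s by (simp add: paths_def)
  have supp: "1 \<le> i \<and> i \<le> n" if "i \<in> U \<or> i \<in> D" for i
    using that s by (force simp: paths_def U_def D_def)
  have fin: "finite U" "finite D"
    by (rule finite_subset[of _ "{1..n}"]; use supp in auto)+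
  have height: "height s i = int (rank U i) - int (rank D i)" for i
  proof -
    have "{j \<in> {1..i}. s j = 1} = {j \<in> U. j \<le> i}" "{j \<in> {1..i}. s j = -1} = {j \<in> D. j \<le> i}"
      using supp by (auto simp: U_def D_def)
    then show ?thesis
      unfolding rank_def by (subst height_eq_card[OF val]) simp
  qed
  have nonneg: "rank D i \<le> rank U i" if "i \<le> n" for i
    using s that height[of i] by (auto simp: paths_def)
  have flat: "rank D i = rank U i" if "i \<in> {1..n}" "i \<notin> U" "i \<notin> D" for i
    using s that height[of i] val[of i] by (auto simp: paths_def U_def D_def)
  have "rank U n = card U" "rank D n = card D"
    unfolding rank_def using supp by (auto intro!: arg_cong[where f = card])
  then have card: "card U = card D"
    using s height[of n] by (simp add: paths_def)
  have disj: "U \<inter> D = {}"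
    by (auto simp: U_def D_def)
  obtain \<pi> where up: "\<And>u. u \<in> U \<Longrightarrow> \<pi> u \<in> D \<and> rank D (\<pi> u) = rank U u"
    and down: "\<And>d. d \<in> D \<Longrightarrow> \<pi> d \<in> U \<and> rank U (\<pi> d) = rank D d"
    and fixed: "\<And>i. i \<notin> U \<Longrightarrow> i \<notin> D \<Longrightarrow> \<pi> i = i" and invol: "\<And>i. \<pi> (\<pi> i) = i"
    using rank_matching[OF fin disj card] by blast
  \<comment> \<open>If \<open>\<pi> u\<close> came first, \<open>rank D (\<pi> u) = rank U u\<close>
    would exceed \<open>rank U (\<pi> u)\<close>, giving a negative height at
    \<open>\<pi> u\<close>.\<close>
  have exc: "u < \<pi> u" if "u \<in> U" for u
  proof (rule ccontr)
    assume "\<not> u < \<pi> u"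
    then have "\<pi> u < u"
      using up[OF that] disj that by (metis disjoint_iff linorder_neqE_nat)
    then have "rank U (\<pi> u) < rank U u"
      using that by (rule rank_less)
    then show False
      using up[OF that] nonneg[of "\<pi> u"] supp[of "\<pi> u"] by simp
  qed
  have defc: "\<pi> d < d" if "d \<in> D" for d
    using exc[of "\<pi> d"] down[OF that] by (simp add: invol)
  have up_mono: "\<pi> u < \<pi> v" if "u \<in> U" "v \<in> U" "u < v" for u v
    using rank_less[of u v U] rank_mono[of "\<pi> v" "\<pi> u" D] up that by (metis not_le)
  have down_mono: "\<pi> c < \<pi> d" if "c \<in> D" "d \<in> D" "c < d" for c d
    using rank_less[of c d D] rank_mono[of "\<pi> d" "\<pi> c" U] down that by (metis not_le)
  have in_U: "i \<in> U" if "i < \<pi> i" for i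
    using that fixed[of i] defc[of i] by fastforce
  have in_D: "i \<in> D" if "\<pi> i < i" for i
    using that fixed[of i] exc[of i] by fastforce
  have "path_of \<pi> i = s i" for i
    using val[of i] exc[of i] defc[of i] fixed[of i] by (auto simp: path_of_def U_def D_def)
  then have "path_of \<pi> = s" ..
  moreover have "\<pi> permutes {1..n}"
    unfolding permutes_def using invol fixed supp by (metis atLeastAtMost_iff)
  moreover have "\<pi> \<circ> \<pi> = id"
    using invol by auto
  moreover have "\<not> contains_pattern n \<pi> [3, 2, 1]"
    unfolding contains_321_iff
  proof clarify
    fix i j k
    assume ijk: "1 \<le> i" "i < j" "j < k" "k \<le> n" "\<pi> j < \<pi> i" "\<pi> k < \<pi> j"
    \<comment> \<open>The middle position decides: if it is up then so is \<open>i\<close>, if down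
      then so is \<open>k\<close>, and monotonicity fails on that pair; if flat, it lies under the
      arc from \<open>i\<close>.\<close>
    consider "j \<in> U" | "j \<in> D" | "j \<notin> U" "j \<notin> D" by blast
    then show False
    proof cases
      case 1
      then have "i \<in> U" using exc[of j] ijk by (intro in_U) simp
      then show False using up_mono[of i j] 1 ijk by simp
    next
      case 2
      then have "k \<in> D" using defc[of j] ijk by (intro in_D) simp
      then show False using down_mono[of j k] 2 ijk by simp
    next
      case 3
      then have "j < \<pi> i" using fixed ijk by simp
      then have "i \<in> U" using ijk by (intro in_U) simp
      \<comment> \<open>The arc from \<open>i\<close> is still open at \<open>j\<close>, so the
        height there is positive.\<close>
      have "rank D j < rank D (\<pi> i)"
        using \<open>j < \<pi> i\<close> up[OF \<open>i \<in> U\<close>] by (intro rank_less) simp_all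
      also have "\<dots> \<le> rank U j"
        using up[OF \<open>i \<in> U\<close>] rank_mono[of i j U] ijk by simp
      finally show False using flat[of j] 3 ijk by simp
    qed
  qed
  ultimately show thesis
    by (intro that[of \<pi>]) (simp_all add: avoiding_involutions_def)
qed

section \<open>Transfer of the major index sum to paths\<close>

lemma path_of_image: "path_of ` avoiding_involutions n [3, 2, 1] = paths n 0"
proof
  show "path_of ` avoiding_involutions n [3, 2, 1] \<subseteq> paths n 0"
    using avoiding_involution.path_of_in_paths by (auto simp: avoiding_involution_def)
  show "paths n 0 \<subseteq> path_of ` avoiding_involutions n [3, 2, 1]"
    using path_of_surj by (metis image_eqI subsetI)
qed

theorem theorem3p3:
  fixes n :: nat
  assumes "n \<ge> 1"
  shows "(\<Sum>\<pi>\<in>avoiding_involutions n [3, 2, 1]. q_var ^ maj n \<pi>) = q_binomial q_var n (n div 2)"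
proof -
  have "(\<Sum>\<pi>\<in>avoiding_involutions n [3, 2, 1]. q_var ^ maj n \<pi>) =
      (\<Sum>\<pi>\<in>avoiding_involutions n [3, 2, 1]. q_var ^ peak_sum n (path_of \<pi>))"
    by (simp add: avoiding_involution.maj_eq_peak_sum avoiding_involution_def)
  also have "\<dots> = path_gf q_var n 0"
    unfolding path_gf_def path_of_image[symmetric] sum.reindex[OF inj_on_path_of] by simp
  also have "\<dots> = q_binomial q_var n (n div 2)"
    using path_gf_eq_q_binomial[of q_var n 0] q_var_power_neq_1 by simp
  finally show ?thesis .
qed

end
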